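(* Let $d\ge 1$, let $K$ be a compact subset of $\mathbb{R}^d$, and let $\mu$ be a non-atomic, finite Borel measure supported on $K$ which is absolutely $\alpha$-friendly for some $\alpha>0$. Suppose further that there exist positive constants $a,b,\delta,r_0$ such that $$a\,r^{\delta}\le\mu(B(x,r))\le b\,r^{\delta}\qquad\text{for all }x\in K\text{ and all }r<r_0.$$ Let $\psi:\mathbb{R}^+\to\mathbb{R}^+$ be a real, positive, decreasing function. Then for every $s\le\delta$ (with $s\ge 0$), $$\mathcal{H}^s(W_K(\psi))=0\quad\text{if}\quad\sum_{r=1}^{\infty} r^{\alpha\frac{d+1}{d}-1}\,\psi(r)^{\alpha+s-\delta}<\infty.$$
   Context: For a real, positive, decreasing function $\psi:\mathbb{R}^+\to\mathbb{R}^+$, $W(\psi):=\{\mathbf{x}\in\mathbb{R}^d:\ \max_{1\le i\le d}|x_i-p_i/q|\le\psi(q)\text{ for infinitely many }(\mathbf{p},q)\in\mathbb{Z}^d\times\mathbb{N}\}$ and $W_K(\psi):=K\cap W(\psi)$. $B(x,r)$ is the Euclidean ball of centre $x$ and radius $r$. $\mu$ is doubling if there exist $D,r_0>0$ with $\mu(B(x,2r))\le D\mu(B(x,r))$ for all $x\in K$, $r<r_0$. For an affine hyperplane $L$ of dimension $d-1$ and $\epsilon>0$, $L^{(\epsilon)}$ is its $\epsilon$-neighbourhood (for $d=1$, $L$ is a point $a$ and $L^{(\epsilon)}=B(a,\epsilon)$). $\mu$ is absolutely $\alpha$-decaying if there exist $C,\alpha,r_0>0$ such that for every such $L$ and every $\epsilon>0$,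 $\mu(B(x,r)\cap L^{(\epsilon)})\le C(\epsilon/r)^{\alpha}\mu(B(x,r))$ for all $x\in K$, $r<r_0$. $\mu$ is absolutely $\alpha$-friendly if it is doubling and absolutely $\alpha$-decaying. $\mathcal{H}^s$ denotes $s$-dimensional Hausdorff measure, defined by $\mathcal{H}^s(X)=\lim_{\rho\to0}\inf\{\sum_i r_i^s\}$, the infimum over countable covers of $X$ by Euclidean balls of radii $r_i\le\rho$. *)

theory Defs
  imports "HOL-Analysis.Analysis"
begin

text \<open>
  Euclidean space of dimension \<open>d \<ge> 1\<close> is \<^typ>\<open>real ^ 'd\<close> with \<open>d = CARD('d)\<close>.
  The Euclidean ball \<open>B(x,r)\<close> is the open ball \<^term>\<open>ball x r\<close>, and only radii \<open>r > 0\<close> are considered.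
\<close>

definition well_approximable :: "(real \<Rightarrow> real) \<Rightarrow> (real ^ 'd) set" where
  "well_approximable \<psi> =
     {x. infinite {(p :: int ^ 'd, q :: nat). q > 0 \<and>
            (MAX i\<in>UNIV. \<bar>x $ i - of_int (p $ i) / real q\<bar>) \<le> \<psi> (real q)}}"

definition is_atom :: "'a measure \<Rightarrow> 'a set \<Rightarrow> bool" where
  "is_atom M A \<longleftrightarrow> A \<in> sets M \<and> emeasure M A > 0 \<and>
     (\<forall>B\<in>sets M. B \<subseteq> A \<longrightarrow> emeasure M B = 0 \<or> emeasure M (A - B) = 0)"

definition non_atomic :: "'a measure \<Rightarrow> bool" where
  "non_atomic M \<longleftrightarrow> (\<nexists>A. is_atom M A)"

definition doubling :: "'a::metric_space set \<Rightarrow> 'a measure \<Rightarrow> bool" where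
  "doubling K \<mu> \<longleftrightarrow>
     (\<exists>D>0. \<exists>r\<^sub>0>0. \<forall>x\<in>K. \<forall>r. 0 < r \<and> r < r\<^sub>0 \<longrightarrow>
        emeasure \<mu> (ball x (2 * r)) \<le> ennreal D * emeasure \<mu> (ball x r))"

text \<open>For \<open>d = 1\<close> the affine hyperplanes are exactly the singletons.\<close>

definition affine_hyperplane :: "'a::euclidean_space set \<Rightarrow> bool" where
  "affine_hyperplane L \<longleftrightarrow> affine L \<and> aff_dim L = int DIM('a) - 1"

definition nbhd :: "'a::metric_space set \<Rightarrow> real \<Rightarrow> 'a set" where
  "nbhd L \<epsilon> = (\<Union>z\<in>L. ball z \<epsilon>)"

definition absolutely_decaying :: "real \<Rightarrow> 'a::euclidean_space set \<Rightarrow> 'a measure \<Rightarrow> bool" where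
  "absolutely_decaying \<alpha> K \<mu> \<longleftrightarrow> \<alpha> > 0 \<and>
     (\<exists>C>0. \<exists>r\<^sub>0>0. \<forall>L. affine_hyperplane L \<longrightarrow>
        (\<forall>\<epsilon>>0. \<forall>x\<in>K. \<forall>r. 0 < r \<and> r < r\<^sub>0 \<longrightarrow>
           emeasure \<mu> (ball x r \<inter> nbhd L \<epsilon>)
             \<le> ennreal (C * (\<epsilon> / r) powr \<alpha>) * emeasure \<mu> (ball x r)))"

definition absolutely_friendly :: "real \<Rightarrow> 'a::euclidean_space set \<Rightarrow> 'a measure \<Rightarrow> bool" where
  "absolutely_friendly \<alpha> K \<mu> \<longleftrightarrow> doubling K \<mu> \<and> absolutely_decaying \<alpha> K \<mu>"

text \<open>
  Countable families of balls are indexed by arbitrary subsets \<open>I\<close> of \<^typ>\<open>nat\<close>, so that finite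
  (and empty) covers are included; this matters for \<open>s = 0\<close>. The radii are required to be positive
  because \<open>0 powr 0 = 0\<close>.
\<close>

definition hausdorff_content :: "real \<Rightarrow> real \<Rightarrow> 'a::metric_space set \<Rightarrow> ennreal" where
  "hausdorff_content s \<rho> X =
     Inf {(\<Sum>\<^sub>\<infinity>i\<in>I. ennreal (r i powr s)) | (I :: nat set) c r.
            (\<forall>i\<in>I. 0 < r i \<and> r i \<le> \<rho>) \<and> X \<subseteq> (\<Union>i\<in>I. ball (c i) (r i))}"

definition hausdorff_measure :: "real \<Rightarrow> 'a::metric_space set \<Rightarrow> ennreal" where
  "hausdorff_measure s X = Lim (at_right 0) (\<lambda>\<rho>. hausdorff_content s \<rho> X)"

lemma hausdorff_content_antimono:
  assumes "\<rho> \<le> \<rho>'"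
  shows "hausdorff_content s \<rho>' X \<le> hausdorff_content s \<rho> X"
  unfolding hausdorff_content_def
  by (rule Inf_superset_mono) (use assms in \<open>fastforce intro: order_trans\<close>)

text \<open>The limit defining the Hausdorff measure always exists.\<close>

lemma hausdorff_content_tendsto:
  "((\<lambda>\<rho>. hausdorff_content s \<rho> X) \<longlongrightarrow> hausdorff_measure s X) (at_right 0)"
proof -
  let ?S = "SUP \<rho>\<in>{0<..}. hausdorff_content s \<rho> X"
  have "((\<lambda>\<rho>. hausdorff_content s \<rho> X) \<longlongrightarrow> ?S) (at_right 0)"
  proof (rule order_tendstoI)
    fix a assume "a < ?S"
    then obtain \<rho> where \<rho>: "\<rho> > 0" "a < hausdorff_content s \<rho> X"
      by (auto simp: less_SUP_iff)
    show "\<forall>\<^sub>F \<rho> in at_right 0. a < hausdorff_content s \<rho> X"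
      unfolding eventually_at_right_field
      using \<rho> hausdorff_content_antimono by (metis less_imp_le order_less_le_trans)
  next
    fix a assume "?S < a"
    then show "\<forall>\<^sub>F \<rho> in at_right 0. hausdorff_content s \<rho> X < a"
      unfolding eventually_at_right_field
      by (metis SUP_upper greaterThan_iff order_le_less_trans zero_less_one)
  qed
  then show ?thesis
    unfolding hausdorff_measure_def using tendsto_Lim trivial_limit_at_right_real by metis
qed

end

theory Submission
  imports Defs
begin

text \<open>
  For \<open>2\<^sup>n \<le> q < 2\<^bsup>n+1\<^esup>\<close>, the rational points with denominator \<open>q\<close> inside a ball of
  radius \<open>r \<asymp> 2\<^bsup>-n(d+1)/d\<^esup>\<close> lie on one hyperplane, because \<open>d + 1\<close> affinely independent ones would
  give a nonzero integer determinant of absolute value less than 1. So the points of \<open>K\<close> that are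
  \<open>\<psi>\<close>-approximable at level \<open>n\<close> lie within \<open>O(\<rho>)\<close>, \<open>\<rho> = \<psi>(2\<^sup>n)\<close>, of one hyperplane in each of
  \<open>O(r\<^bsup>-\<delta>\<^esup>)\<close> balls of radius \<open>r\<close>; by decay this set has measure \<open>O((\<rho>/r)\<^bsup>\<alpha>\<^esup>)\<close>, so
  \<open>O(\<rho>\<^bsup>\<alpha>-\<delta>\<^esup> r\<^bsup>-\<alpha>\<^esup>)\<close> balls of radius \<open>2\<rho>\<close> cover it. The resulting cover has \<open>s\<close>-cost
  \<open>O(2\<^bsup>n\<alpha>(d+1)/d\<^esup> \<psi>(2\<^sup>n)\<^bsup>\<alpha>+s-\<delta>\<^esup>)\<close>, which is summable by Cauchy condensation. Convergence of the
  series also forces \<open>\<alpha> + s - \<delta> > 0\<close>, and with \<open>s \<le> \<delta>\<close> it forces \<open>d \<rho> \<le> r\<close> for all large \<open>n\<close>.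
\<close>

section \<open>Determinants and the simplex lemma\<close>

lemma det_in_Ints:
  fixes A :: "real^'n^'n"
  assumes "\<And>i j. A $ i $ j \<in> \<int>"
  shows "det A \<in> \<int>"
  unfolding det_def using assms by (intro Ints_sum Ints_mult Ints_prod) auto

text \<open>Since \<open>k\<close> is outside \<open>F\<close>, row \<open>k\<close> stays intact
  while the rows in \<open>F\<close> are treated one at a time, so each induction step is a single
  elementary row operation. With \<open>F\<close> the set of all rows but \<open>k\<close>, this
  passes from points to their differences.\<close>

lemma det_subtract_row:
  fixes A :: "real^'n^'n"
  assumes "finite F" "k \<notin> F"
  shows "det (\<chi> i. if i \<in> F then A $ i - A $ k else A $ i) = det A"
  using assms
proof (induction F rule: finite_induct)
  case empty
  then show ?case by simp
next
  case (insert j F)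
  define B where "B = (\<chi> i. if i \<in> F then A $ i - A $ k else A $ i)"
  have "(\<chi> i. if i \<in> insert j F then A $ i - A $ k else A $ i)
      = (\<chi> i. if i = j then row j B + (-1) *s row k B else row i B)"
    using insert by (auto simp: B_def row_def vec_eq_iff)
  then have "det (\<chi> i. if i \<in> insert j F then A $ i - A $ k else A $ i) = det B"
    using det_row_operation[of j k B "-1"] insert by auto
  then show ?case using insert by (simp add: B_def)
qed

text \<open>In the Leibniz expansion a permutation that moves \<open>None\<close> sends some
  \<open>Some i\<close> to \<open>None\<close> and so picks up a zero of that column. Every other
  term is at most \<open>e ^ CARD('n)\<close>, and there are \<open>fact (Suc CARD('n))\<close>
  permutations.\<close>

lemma abs_det_bordered_le:
  fixes M :: "real^('n::finite option)^('n option)"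
  assumes e: "0 \<le> e" and M: "\<And>i j. \<bar>M $ Some i $ Some j\<bar> \<le> e"
    and M0: "\<And>i. M $ Some i $ None = 0" and M1: "\<bar>M $ None $ None\<bar> \<le> 1"
  shows "\<bar>det M\<bar> \<le> fact (Suc CARD('n)) * e ^ CARD('n)"
proof -
  have term_le: "\<bar>of_int (sign p) * (\<Prod>i\<in>UNIV. M $ i $ p i)\<bar> \<le> e ^ CARD('n)"
    if p: "p permutes (UNIV :: 'n option set)" for p
  proof -
    have split: "(\<Prod>i\<in>UNIV. M $ i $ p i) = M $ None $ p None * (\<Prod>i\<in>UNIV. M $ Some i $ p (Some i))"
      by (simp add: UNIV_option_conv prod.reindex)
    have sgn: "\<bar>of_int (sign p) :: real\<bar> = 1"
      by (simp add: sign_def)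
    show ?thesis
    proof (cases "p None = None")
      case True
      have "\<exists>j. p (Some i) = Some j" for i
        using True permutes_inj[OF p] by (metis injD not_None_eq option.distinct(1))
      then have "\<bar>M $ Some i $ p (Some i)\<bar> \<le> e" for i
        using M by metis
      then have "(\<Prod>i\<in>UNIV. \<bar>M $ Some i $ p (Some i)\<bar>) \<le> (\<Prod>i\<in>(UNIV::'n set). e)"
        by (intro prod_mono) auto
      then have "\<bar>M $ None $ None\<bar> * (\<Prod>i\<in>UNIV. \<bar>M $ Some i $ p (Some i)\<bar>) \<le> 1 * e ^ CARD('n)"
        using M1 by (intro mult_mono) (auto intro: prod_nonneg)
      then show ?thesis
        by (simp add: split abs_mult sgn True abs_prod)
    next
      case False
      obtain k where k: "p k = None"
        using permutes_surj[OF p] by (metis surjD)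
      then obtain i where "p (Some i) = None"
        using False by (cases k) auto
      then have prod0: "(\<Prod>i\<in>UNIV. M $ Some i $ p (Some i)) = 0"
        using M0 by (metis UNIV_I finite_class.finite_UNIV prod_zero)
      show ?thesis unfolding split prod0 using e by simp
    qed
  qed
  have "\<bar>det M\<bar> \<le> (\<Sum>p | p permutes (UNIV :: 'n option set). e ^ CARD('n))"
    unfolding det_def by (rule order_trans[OF sum_abs]) (intro sum_mono term_le, simp)
  then show ?thesis
    by (simp add: card_permutations algebra_simps)
qed

definition rational_points :: "nat \<Rightarrow> (real^'d) set" where
  "rational_points Q = {\<chi> i. of_int (p $ i) / real q | (p :: int^'d) q. 0 < q \<and> q \<le> Q}"

text \<open>The simplex lemma of Davenport and Schmidt.\<close>

lemma rational_points_in_ball_subset_hyperplane: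
  fixes x :: "real^'d"
  assumes e: "0 \<le> e"
    and small: "fact (Suc CARD('d)) * (2 * e) ^ CARD('d) * real Q ^ Suc CARD('d) < 1"
  shows "\<exists>L. affine_hyperplane L \<and> ball x e \<inter> rational_points Q \<subseteq> L"
proof (rule ccontr)
  assume contra: "\<not> ?thesis"
  define S where "S = ball x e \<inter> (rational_points Q :: (real^'d) set)"
  have no_hyp: False if "a \<noteq> 0" "S \<subseteq> {y. a \<bullet> y = b}" for a b
  proof -
    have "affine_hyperplane {y. a \<bullet> y = b}"
      unfolding affine_hyperplane_def using that(1) by (simp add: affine_hyperplane aff_dim_hyperplane)
    then show False using contra that(2) unfolding S_def by blast
  qed
  have "\<not> aff_dim S < int DIM(real^'d)"
    using aff_lowdim_subset_hyperplane[of S] no_hyp by blast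
  then have dimS: "aff_dim S = int CARD('d)"
    using aff_dim_le_DIM[of S] by simp
  obtain B where B: "B \<subseteq> S" "\<not> affine_dependent B" "affine hull S = affine hull B"
    using affine_basis_exists[of S] by blast
  have "aff_dim B = int CARD('d)"
    using dimS B(3) by (metis aff_dim_affine_hull)
  then have cardB: "card B = CARD('d option)"
    using aff_dim_affine_independent[OF B(2)] by simp
  then have "finite B"
    by (intro card_ge_0_finite) simp
  then obtain f where f: "bij_betw f (UNIV :: 'd option set) B"
    using cardB finite_same_card_bij[of "UNIV :: 'd option set" B] by auto
  have fB: "range f = B"
    using f by (simp add: bij_betw_def)
  have "f k \<in> rational_points Q" for k
    using fB B(1) unfolding S_def by blast
  then have "\<forall>k. \<exists>p q. 0 < q \<and> q \<le> Q \<and> f k = (\<chi> i. of_int (p $ i) / real q)"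
    unfolding rational_points_def by blast
  then obtain p :: "'d option \<Rightarrow> int^'d" and q :: "'d option \<Rightarrow> nat"
    where pq: "\<And>k. 0 < q k" "\<And>k. q k \<le> Q" "\<And>k. f k = (\<chi> i. of_int (p k $ i) / real (q k))"
    by metis
  \<comment> \<open>Appending a coordinate 1 turns affine independence of the points
    \<open>f k\<close> into invertibility of a square matrix.\<close>
  define A :: "real^('d option)^('d option)"
    where "A = (\<chi> k j. case j of None \<Rightarrow> 1 | Some i \<Rightarrow> f k $ i)"
  have detA: "det A \<noteq> 0"
  proof
    assume "det A = 0"
    then have "\<not> (\<exists>B. B ** A = mat 1)"
      by (metis det_I det_mul mult_zero_right zero_neq_one)
    \<comment> \<open>A kernel vector is the equation of a hyperplane through all
      \<open>f k\<close>, hence through \<open>S\<close>, which has the same affine hull as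
      \<open>B\<close>. Its normal \<open>w\<close> is nonzero, as otherwise the constant term would
      vanish too.\<close>
    then obtain z where z: "A *v z = 0" "z \<noteq> 0"
      unfolding matrix_left_invertible_ker by blast
    define w where "w = (\<chi> i. z $ Some i)"
    have eq: "w \<bullet> f k = - z $ None" for k
    proof -
      have "(A *v z) $ k = z $ None + w \<bullet> f k"
        by (simp add: matrix_vector_mult_def A_def UNIV_option_conv sum.reindex inner_vec_def
            w_def mult.commute)
      then show ?thesis using z(1) by simp
    qed
    have "w \<noteq> 0"
    proof
      assume "w = 0"
      then have "z $ Some i = 0" for i
        by (simp add: w_def vec_eq_iff)
      moreover have "z $ None = 0"
        using eq[of None] \<open>w = 0\<close> by simp
      ultimately have "z $ k = 0" for k by (cases k) auto
      then show False using z(2) by (simp add: vec_eq_iff)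
    qed
    moreover have "affine hull B \<subseteq> {y. w \<bullet> y = - z $ None}"
      using eq fB by (intro hull_minimal affine_hyperplane) auto
    then have "S \<subseteq> {y. w \<bullet> y = - z $ None}"
      using B(3) hull_subset[of S affine] by auto
    ultimately show False using no_hyp by blast
  qed
  \<comment> \<open>Clearing the denominators row by row gives an integer matrix, so its nonzero
    determinant has absolute value at least 1.\<close>
  define N where "N = (\<chi> k. real (q k) *s A $ k)"
  have "N $ k $ j \<in> \<int>" for k j
    using pq(1)[of k] by (cases j) (auto simp: N_def A_def pq(3))
  then have "det N \<in> \<int>" by (rule det_in_Ints)
  moreover have detN: "det N = (\<Prod>k\<in>UNIV. real (q k)) * det A"
    unfolding N_def by (subst det_rows_mul) simp
  moreover have "(\<Prod>k\<in>UNIV. real (q k)) \<noteq> 0"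
    using pq(1) by simp
  ultimately have "1 \<le> \<bar>det N\<bar>"
    using detA by (intro Ints_nonzero_abs_ge1) auto
  \<comment> \<open>Subtracting row \<open>None\<close> clears the column of ones below its corner
    and leaves differences of two points of the ball, with entries below its diameter
    \<open>2 * e\<close>.\<close>
  define M where "M = (\<chi> k. if k \<in> range Some then A $ k - A $ None else A $ k)"
  have "det M = det A"
    unfolding M_def by (rule det_subtract_row) auto
  moreover have "\<bar>det M\<bar> \<le> fact (Suc CARD('d)) * (2 * e) ^ CARD('d)"
  proof (rule abs_det_bordered_le)
    fix i j
    have "f k \<in> ball x e" for k
      using fB B(1) unfolding S_def by blast
    then have "dist x (f k) < e" for k
      by simp
    then have "dist (f (Some i)) (f None) < 2 * e"
      using dist_triangle3[of "f (Some i)" "f None" x] by (metis add_strict_mono le_less_trans mult_2)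
    then show "\<bar>M $ Some i $ Some j\<bar> \<le> 2 * e"
      using component_le_norm_cart[of "f (Some i) - f None" j] by (simp add: M_def A_def dist_norm)
  qed (use e in \<open>auto simp: M_def A_def\<close>)
  moreover have "(\<Prod>k\<in>UNIV. real (q k)) \<le> (\<Prod>k\<in>(UNIV::'d option set). real Q)"
    using pq(2) by (intro prod_mono) auto
  then have "(\<Prod>k\<in>UNIV. real (q k)) \<le> real Q ^ Suc CARD('d)"
    by simp
  ultimately have "\<bar>det N\<bar> \<le> real Q ^ Suc CARD('d) * (fact (Suc CARD('d)) * (2 * e) ^ CARD('d))"
    unfolding detN abs_mult using e by (intro mult_mono) (auto simp: prod_nonneg)
  then show False
    using \<open>1 \<le> \<bar>det N\<bar>\<close> small by (simp add: mult_ac)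
qed

section \<open>Hausdorff measure of limsup sets\<close>

text \<open>Covers arise with other index types, so the index set is transported to a set of
  naturals. A bound on finite subsums suffices because an infinite sum in \<open>ennreal\<close> is
  the supremum of these.\<close>

lemma hausdorff_content_le_countable_cover:
  fixes X :: "'a::metric_space set" and I :: "'i set"
  assumes I: "countable I" and r: "\<And>i. i \<in> I \<Longrightarrow> 0 < r i \<and> r i \<le> \<rho>"
    and cover: "X \<subseteq> (\<Union>i\<in>I. ball (c i) (r i))"
    and bound: "\<And>F. finite F \<Longrightarrow> F \<subseteq> I \<Longrightarrow> (\<Sum>i\<in>F. r i powr s) \<le> B"
  shows "hausdorff_content s \<rho> X \<le> ennreal B"
proof -
  define J where "J = to_nat_on I ` I"
  define g where "g = inv_into I (to_nat_on I)"
  have g_in: "g j \<in> I" if "j \<in> J" for j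
    using that unfolding g_def J_def by (rule inv_into_into)
  have g_inv: "g (to_nat_on I i) = i" if "i \<in> I" for i
    unfolding g_def using inj_on_to_nat_on[OF I] that by (rule inv_into_f_f)
  have inj_g: "inj_on g J"
    unfolding g_def J_def by (rule inj_on_inv_into) simp
  have "X \<subseteq> (\<Union>j\<in>J. ball (c (g j)) (r (g j)))"
    using cover g_inv unfolding J_def by auto
  then have "hausdorff_content s \<rho> X \<le> (\<Sum>\<^sub>\<infinity>j\<in>J. ennreal (r (g j) powr s))"
    unfolding hausdorff_content_def using r g_in
    by (intro Inf_lower CollectI exI[of _ J] exI[of _ "\<lambda>j. c (g j)"] exI[of _ "\<lambda>j. r (g j)"]) auto
  also have "\<dots> \<le> ennreal B"
  proof (rule infsum_le_finite_sums)
    fix F assume F: "finite F" "F \<subseteq> J"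
    have "(\<Sum>j\<in>F. ennreal (r (g j) powr s)) = ennreal (\<Sum>i\<in>g ` F. r i powr s)"
      using inj_on_subset[OF inj_g F(2)] by (simp add: sum.reindex sum_ennreal)
    also have "\<dots> \<le> ennreal B"
      using F g_in by (intro ennreal_leI bound) auto
    finally show "(\<Sum>j\<in>F. ennreal (r (g j) powr s)) \<le> ennreal B" .
  qed (simp add: nonneg_summable_on_complete)
  finally show ?thesis .
qed

text \<open>A Hausdorff version of the Borel-Cantelli lemma: for every \<open>M\<close> the covers
  of the levels \<open>n \<ge> M\<close> together cover \<open>X\<close>, and their cost is a tail
  of a convergent series.\<close>

lemma hausdorff_measure_limsup_eq_0:
  fixes X :: "'a::metric_space set"
  assumes fin: "\<And>n. n \<ge> N \<Longrightarrow> finite (Z n)" and pos: "\<And>n. n \<ge> N \<Longrightarrow> 0 < t n"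
    and cover: "\<And>n. n \<ge> N \<Longrightarrow> E n \<subseteq> (\<Union>z\<in>Z n. ball z (t n))"
    and lim: "t \<longlonglongrightarrow> 0"
    and sum: "summable (\<lambda>n. real (card (Z n)) * t n powr s)"
    and X: "\<And>x m. x \<in> X \<Longrightarrow> \<exists>n\<ge>m. x \<in> E n"
  shows "hausdorff_measure s X = 0"
proof -
  have "hausdorff_content s \<rho> X = 0" if "\<rho> > 0" for \<rho>
  proof -
    \<comment> \<open>The summand 0 gives the shape that \<open>ennreal_le_epsilon\<close>
      expects.\<close>
    have le: "hausdorff_content s \<rho> X \<le> 0 + ennreal \<epsilon>" if \<epsilon>: "\<epsilon> > 0" for \<epsilon>
    proof -
      define f where "f n = real (card (Z n)) * t n powr s" for n
      have f0: "f n \<ge> 0" for n by (simp add: f_def)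
      have sumf: "summable f" using sum by (simp add: f_def[abs_def])
      obtain N1 where N1: "\<And>n. n \<ge> N1 \<Longrightarrow> norm (\<Sum>i. f (i + n)) < \<epsilon>"
        using suminf_exist_split[OF \<epsilon> sumf] by blast
      have "\<forall>\<^sub>F n in sequentially. t n < \<rho>"
        using lim \<open>\<rho> > 0\<close> by (rule order_tendstoD)
      then obtain N2 where N2: "\<And>n. n \<ge> N2 \<Longrightarrow> t n < \<rho>"
        by (auto simp: eventually_sequentially)
      define M where "M = max N (max N1 N2)"
      have M: "N \<le> M" "N1 \<le> M" "N2 \<le> M" by (auto simp: M_def)
      have "hausdorff_content s \<rho> X \<le> ennreal \<epsilon>"
      proof (rule hausdorff_content_le_countable_cover)
        \<comment> \<open>Balls are indexed by pairs of level and centre, because one centre may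
          occur at several levels with different radii.\<close>
        show "countable (SIGMA n:{M..}. Z n)"
          using fin M by (intro countable_SIGMA) (auto intro: countable_finite)
        show "0 < t (fst i) \<and> t (fst i) \<le> \<rho>" if "i \<in> (SIGMA n:{M..}. Z n)" for i
          using that pos N2 M by (force intro: less_imp_le)
        show "X \<subseteq> (\<Union>i\<in>(SIGMA n:{M..}. Z n). ball (snd i) (t (fst i)))"
        proof
          fix x assume "x \<in> X"
          then obtain n where n: "n \<ge> M" "x \<in> E n" using X by blast
          then obtain z where "z \<in> Z n" "x \<in> ball z (t n)"
            using cover[of n] M by auto
          then show "x \<in> (\<Union>i\<in>(SIGMA n:{M..}. Z n). ball (snd i) (t (fst i)))"
            using n by (intro UN_I[of "(n, z)"]) auto
        qed
        fix F assume F: "finite F" "F \<subseteq> (SIGMA n:{M..}. Z n)"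
        \<comment> \<open>A finite set of pairs meets finitely many levels, so its cost is at most a
          partial sum of the tail.\<close>
        obtain m where m: "\<And>i. i \<in> F \<Longrightarrow> fst i < M + m"
        proof -
          have "finite (fst ` F)" using F by simp
          then obtain k where "\<forall>n\<in>fst ` F. n < k"
            using finite_nat_set_iff_bounded by blast
          then show thesis by (intro that[of k]) (auto simp: trans_less_add2)
        qed
        have finS: "finite (SIGMA n:{M..<M + m}. Z n)"
          using fin M by (intro finite_SigmaI) auto
        have "(\<Sum>i\<in>F. t (fst i) powr s) \<le> (\<Sum>i\<in>(SIGMA n:{M..<M + m}. Z n). t (fst i) powr s)"
          using F m by (intro sum_mono2 finS) (fastforce, simp)
        also have "\<dots> = (\<Sum>n\<in>{M..<M + m}. \<Sum>z\<in>Z n. t n powr s)"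
          using fin M by (subst sum.Sigma) (auto simp: case_prod_unfold)
        also have "\<dots> = (\<Sum>n\<in>{M..<M + m}. f n)"
          by (simp add: f_def)
        also have "\<dots> = (\<Sum>i<m. f (i + M))"
          using sum.shift_bounds_nat_ivl[of f 0 M m] by (simp add: add.commute atLeast0LessThan)
        also have "\<dots> \<le> (\<Sum>i. f (i + M))"
          using sumf f0 by (intro sum_le_suminf) (auto simp: summable_iff_shift)
        also have "\<dots> \<le> \<epsilon>"
          using N1[OF M(2)] by simp
        finally show "(\<Sum>i\<in>F. t (fst i) powr s) \<le> \<epsilon>" .
      qed
      then show ?thesis by simp
    qed
    have "hausdorff_content s \<rho> X \<le> 0"
      by (rule ennreal_le_epsilon) (rule le)
    then show ?thesis by simp
  qed
  then have "\<forall>\<^sub>F \<rho> in at_right 0. hausdorff_content s \<rho> X = 0"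
    using eventually_at_right_less[of "0::real"] by (rule eventually_mono[rotated])
  then have "((\<lambda>\<rho>. hausdorff_content s \<rho> X) \<longlongrightarrow> 0) (at_right 0)"
    by (rule tendsto_eventually)
  then show ?thesis
    using tendsto_unique[OF trivial_limit_at_right_real hausdorff_content_tendsto] by blast
qed

section \<open>Condensation of the series to dyadic scales\<close>

text \<open>The weight may increase or decrease with \<open>n\<close>, so the terms need not be
  monotone. On a dyadic block, however, the ratio of \<open>k\<close> to the right end lies between
  1/2 and 1, and its power \<open>\<beta> - 1\<close> is at least \<open>c\<close> for either sign
  of the exponent; \<open>\<phi>\<close> is at least its value at the right end.\<close>

lemma summable_dyadic_condensation:
  fixes \<phi> :: "nat \<Rightarrow> real"
  assumes sum: "summable (\<lambda>n. real (Suc n) powr (\<beta> - 1) * \<phi> (Suc n))"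
    and mono: "\<And>m n. 0 < m \<Longrightarrow> m \<le> n \<Longrightarrow> \<phi> n \<le> \<phi> m" and nonneg: "\<And>n. 0 < n \<Longrightarrow> 0 \<le> \<phi> n"
  shows "summable (\<lambda>n. (2 ^ n) powr \<beta> * \<phi> (2 ^ n))"
proof -
  define g where "g n = real n powr (\<beta> - 1) * \<phi> n" for n
  have sumg: "summable g"
    using sum summable_Suc_iff[of g] by (simp add: g_def)
  have g0: "0 \<le> g n" for n
    using nonneg by (cases "n = 0") (auto simp: g_def)
  define c where "c = (1/2) powr \<bar>\<beta> - 1\<bar>"
  have c: "c > 0" by (simp add: c_def)
  have block: "(2 ^ Suc n) powr \<beta> * \<phi> (2 ^ Suc n) \<le> 2 / c * sum g {2 ^ n..<2 ^ Suc n}" for n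
  proof -
    have "c * (2 ^ Suc n) powr (\<beta> - 1) * \<phi> (2 ^ Suc n) \<le> g k" if k: "k \<in> {2 ^ n..<2 ^ Suc n}" for k
    proof -
      define u where "u = real k / 2 ^ Suc n"
      have "real (2 ^ n) \<le> real k" "real k < real (2 ^ Suc n)"
        using k by (simp_all only: of_nat_le_iff of_nat_less_iff atLeastLessThan_iff)
      then have u: "1/2 \<le> u" "u \<le> 1"
        by (auto simp: u_def field_simps)
      have "c \<le> u powr (\<beta> - 1)"
      proof (cases "\<beta> \<ge> 1")
        case True
        then show ?thesis unfolding c_def using u by (auto intro: powr_mono2)
      next
        case False
        have "c \<le> 1" unfolding c_def by (intro powr_le1) auto
        also have "1 \<le> u powr (\<beta> - 1)"
          using powr_mono2'[of "\<beta> - 1" u 1] u False by simp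
        finally show ?thesis .
      qed
      then have "c * (2 ^ Suc n) powr (\<beta> - 1) \<le> u powr (\<beta> - 1) * (2 ^ Suc n) powr (\<beta> - 1)"
        by (intro mult_right_mono) auto
      also have "\<dots> = real k powr (\<beta> - 1)"
        using u by (subst powr_mult[symmetric]) (auto simp: u_def)
      finally have "c * (2 ^ Suc n) powr (\<beta> - 1) \<le> real k powr (\<beta> - 1)" .
      moreover have "0 < k"
        using k by (metis atLeastLessThan_iff less_le_trans zero_less_numeral zero_less_power)
      ultimately show ?thesis
        unfolding g_def using k c by (intro mult_mono mono nonneg) auto
    qed
    then have "real (card {2 ^ n..<2 ^ Suc n :: nat}) * (c * (2 ^ Suc n) powr (\<beta> - 1) * \<phi> (2 ^ Suc n))
        \<le> sum g {2 ^ n..<2 ^ Suc n}"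
      by (intro sum_bounded_below) auto
    moreover have "(2 ^ Suc n :: real) powr \<beta> = 2 ^ Suc n * (2 ^ Suc n) powr (\<beta> - 1)"
      by (simp add: powr_diff)
    ultimately show ?thesis
      using c by (simp add: field_simps)
  qed
  have dyadic: "(\<Sum>n<m. sum g {2 ^ n..<2 ^ Suc n}) = sum g {1..<2 ^ m}" for m
  proof (induction m)
    case (Suc m)
    have "sum g {1..<2 ^ m} + sum g {2 ^ m..<2 ^ Suc m} = sum g {1..<2 ^ Suc m}"
      by (rule sum.atLeastLessThan_concat) auto
    then show ?case using Suc by simp
  qed simp
  \<comment> \<open>The block from \<open>2 ^ n\<close> controls the term at its right end
    \<open>2 ^ Suc n\<close>, hence the shift by one.\<close>
  have "summable (\<lambda>n. (2 ^ Suc n) powr \<beta> * \<phi> (2 ^ Suc n))"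
  proof (rule summableI_nonneg_bounded)
    fix m
    have "(\<Sum>n<m. (2 ^ Suc n) powr \<beta> * \<phi> (2 ^ Suc n)) \<le> (\<Sum>n<m. 2 / c * sum g {2 ^ n..<2 ^ Suc n})"
      by (intro sum_mono block)
    also have "\<dots> = 2 / c * sum g {1..<2 ^ m}"
      by (simp only: sum_distrib_left[symmetric] dyadic)
    also have "\<dots> \<le> 2 / c * suminf g"
      using c g0 sumg by (intro mult_left_mono sum_le_suminf) auto
    finally show "(\<Sum>n<m. (2 ^ Suc n) powr \<beta> * \<phi> (2 ^ Suc n)) \<le> 2 / c * suminf g" .
  qed (simp add: nonneg)
  then show ?thesis
    using summable_Suc_iff[of "\<lambda>n. (2 ^ n) powr \<beta> * \<phi> (2 ^ n)"] by simp
qed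

section \<open>Separated sets and covers near hyperplanes\<close>

lemma card_mult_le_measure_UN_balls:
  fixes \<mu> :: "'a::metric_space measure"
  assumes "finite_measure \<mu>" "sets \<mu> = sets borel" "finite Z"
    and sep: "pairwise (\<lambda>x y. 2 * t \<le> dist x y) Z"
    and m: "\<And>z. z \<in> Z \<Longrightarrow> m \<le> measure \<mu> (ball z t)"
  shows "real (card Z) * m \<le> measure \<mu> (\<Union>z\<in>Z. ball z t)"
proof -
  interpret finite_measure \<mu> by fact
  have "disjoint_family_on (\<lambda>z. ball z t) Z"
    using sep by (auto simp: disjoint_family_on_def pairwise_def intro!: disjoint_ballI)
  moreover have "(\<lambda>z. ball z t) ` Z \<subseteq> sets \<mu>"
    unfolding assms(2) by auto
  ultimately have "measure \<mu> (\<Union>z\<in>Z. ball z t) = (\<Sum>z\<in>Z. measure \<mu> (ball z t))"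
    using finite_measure_finite_Union[OF \<open>finite Z\<close>] by blast
  then show ?thesis
    using sum_bounded_below[of Z m "\<lambda>z. measure \<mu> (ball z t)"] m by simp
qed

text \<open>Disjoint balls of measure at least \<open>m\<close> bound the size of a separated set,
  so one of greatest cardinality exists. A point of \<open>A\<close> at distance at least
  \<open>2 * t\<close> from all of it could be added.\<close>

lemma exists_maximal_separated_set:
  fixes \<mu> :: "'a::metric_space measure"
  assumes "finite_measure \<mu>" "sets \<mu> = sets borel" "0 < t" "0 < m"
    and m: "\<And>z. z \<in> A \<Longrightarrow> m \<le> measure \<mu> (ball z t)"
  obtains Z where "finite Z" "Z \<subseteq> A" "pairwise (\<lambda>x y. 2 * t \<le> dist x y) Z"
    "A \<subseteq> (\<Union>z\<in>Z. ball z (2 * t))"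
proof -
  interpret finite_measure \<mu> by fact
  define P where "P Z \<longleftrightarrow> finite Z \<and> Z \<subseteq> A \<and> pairwise (\<lambda>x y. 2 * t \<le> dist x y) Z" for Z
  have "card Z \<le> nat \<lfloor>measure \<mu> (space \<mu>) / m\<rfloor>" if "P Z" for Z
  proof -
    have "real (card Z) * m \<le> measure \<mu> (\<Union>z\<in>Z. ball z t)"
      using that m by (intro card_mult_le_measure_UN_balls assms(1,2)) (auto simp: P_def)
    also have "\<dots> \<le> measure \<mu> (space \<mu>)"
      by (rule bounded_measure)
    finally show ?thesis
      using \<open>0 < m\<close> by (simp add: le_nat_floor field_simps)
  qed
  then have "\<forall>Z. P Z \<longrightarrow> card Z < Suc (nat \<lfloor>measure \<mu> (space \<mu>) / m\<rfloor>)"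
    by (simp add: less_Suc_eq_le)
  moreover have "P {}"
    by (simp add: P_def)
  ultimately have "\<exists>Z. P Z \<and> (\<forall>Z'. P Z' \<longrightarrow> card Z' \<le> card Z)"
    by (metis ex_has_greatest_nat)
  then obtain Z where Z: "P Z" and max: "\<And>Z'. P Z' \<Longrightarrow> card Z' \<le> card Z"
    by blast
  have "A \<subseteq> (\<Union>z\<in>Z. ball z (2 * t))"
  proof (rule ccontr)
    assume "\<not> ?thesis"
    then obtain x where "x \<in> A" "x \<notin> (\<Union>z\<in>Z. ball z (2 * t))"
      by blast
    then have x: "x \<in> A" "\<And>z. z \<in> Z \<Longrightarrow> 2 * t \<le> dist z x"
      by (auto simp: not_less)
    then have "x \<notin> Z" using \<open>0 < t\<close> x(2)[of x] by auto
    moreover have "P (insert x Z)"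
      using Z x by (auto simp: P_def pairwise_insert dist_commute)
    ultimately show False using max[of "insert x Z"] Z by (simp add: P_def)
  qed
  then show thesis using Z that by (auto simp: P_def)
qed

text \<open>Two measure counts are combined. The \<open>r\<close>-balls around a separated net
  \<open>J\<close> of \<open>K\<close> are disjoint, which bounds \<open>card J\<close>. The
  \<open>\<rho>\<close>-balls around a separated net \<open>Z\<close> of \<open>E\<close> are
  disjoint too, and lie in the hyperplane slabs inside the balls of radius \<open>3 * r\<close>
  around \<open>J\<close>, whose measure is bounded by decay.\<close>

lemma card_cover_near_hyperplanes:
  fixes \<mu> :: "'a::euclidean_space measure"
  assumes fin: "finite_measure \<mu>" and borel: "sets \<mu> = sets borel"
    and pos: "0 < a" "0 \<le> b" "0 \<le> C" "0 \<le> \<kappa>" "0 < \<rho>" "\<rho> \<le> r" "\<kappa> * \<rho> \<le> r" "3 * r < r\<^sub>0"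
    and lower: "\<And>x t. x \<in> K \<Longrightarrow> 0 < t \<Longrightarrow> t < r\<^sub>0 \<Longrightarrow> a * t powr \<delta> \<le> measure \<mu> (ball x t)"
    and upper: "\<And>x t. x \<in> K \<Longrightarrow> 0 < t \<Longrightarrow> t < r\<^sub>0 \<Longrightarrow> measure \<mu> (ball x t) \<le> b * t powr \<delta>"
    and decay: "\<And>L \<epsilon> x t. affine_hyperplane L \<Longrightarrow> 0 < \<epsilon> \<Longrightarrow> x \<in> K \<Longrightarrow> 0 < t \<Longrightarrow> t < r\<^sub>0 \<Longrightarrow>
        measure \<mu> (ball x t \<inter> nbhd L \<epsilon>) \<le> C * (\<epsilon> / t) powr \<alpha> * measure \<mu> (ball x t)"
    and hyp: "\<And>z. \<exists>L. affine_hyperplane L \<and> ball z (3 * r) \<inter> S \<subseteq> L"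
    and E: "E \<subseteq> K" "\<And>x. x \<in> E \<Longrightarrow> \<exists>v\<in>S. dist x v \<le> \<kappa> * \<rho>"
  obtains Z where "finite Z" "E \<subseteq> (\<Union>z\<in>Z. ball z (2 * \<rho>))"
    "real (card Z) \<le> measure \<mu> (space \<mu>) * C * (\<kappa> + 1) powr \<alpha> * b * 3 powr (\<delta> - \<alpha>) / a\<^sup>2
       * \<rho> powr (\<alpha> - \<delta>) * r powr (- \<alpha>)"
proof -
  interpret finite_measure \<mu> by fact
  have r: "0 < r" "r < r\<^sub>0" "\<rho> < r\<^sub>0" using pos by auto
  obtain J where J: "finite J" "J \<subseteq> K" "pairwise (\<lambda>x y. 2 * r \<le> dist x y) J"
    "K \<subseteq> (\<Union>z\<in>J. ball z (2 * r))"
  proof (rule exists_maximal_separated_set[OF fin borel, of r "a * r powr \<delta>" K])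
  qed (use r pos lower in auto)
  obtain Z where Z: "finite Z" "Z \<subseteq> E" "pairwise (\<lambda>x y. 2 * \<rho> \<le> dist x y) Z"
    "E \<subseteq> (\<Union>z\<in>Z. ball z (2 * \<rho>))"
  proof (rule exists_maximal_separated_set[OF fin borel, of \<rho> "a * \<rho> powr \<delta>" E])
  qed (use r pos lower E in auto)
  obtain L where L: "\<And>z. affine_hyperplane (L z)" "\<And>z. ball z (3 * r) \<inter> S \<subseteq> L z"
    using hyp by metis
  define m where "m = measure \<mu> (space \<mu>)"
  \<comment> \<open>A point of \<open>ball x \<rho>\<close> is within \<open>\<rho>\<close> of
    \<open>x\<close>, which is within \<open>\<kappa> * \<rho>\<close> of a point of
    \<open>S\<close>.\<close>
  define \<eta> where "\<eta> = (\<kappa> + 1) * \<rho>"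
  have \<eta>: "0 < \<eta>" using pos by (simp add: \<eta>_def)
  have "real (card J) * (a * r powr \<delta>) \<le> measure \<mu> (\<Union>z\<in>J. ball z r)"
    using J r lower by (intro card_mult_le_measure_UN_balls[OF fin borel]) auto
  also have "\<dots> \<le> m"
    unfolding m_def by (rule bounded_measure)
  finally have "real (card J) * (a * r powr \<delta>) \<le> m" .
  then have cardJ: "real (card J) \<le> m / (a * r powr \<delta>)"
    using pos r by (simp add: field_simps)
  have "ball x \<rho> \<subseteq> (\<Union>z\<in>J. ball z (3 * r) \<inter> nbhd (L z) \<eta>)" if x: "x \<in> Z" for x
  proof -
    have "x \<in> (\<Union>z\<in>J. ball z (2 * r))" using J(4) Z(2) E(1) x by blast
    then obtain z where z: "z \<in> J" "dist z x < 2 * r" by auto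
    obtain v where v: "v \<in> S" "dist x v \<le> \<kappa> * \<rho>" using E(2) Z(2) x by blast
    \<comment> \<open>The net contributes \<open>2 * r\<close>. The remaining \<open>r\<close>
      absorbs \<open>\<kappa> * \<rho>\<close> here, and \<open>\<rho>\<close> when the whole of
      \<open>ball x \<rho>\<close> is placed in the same ball.\<close>
    have "dist z v < 3 * r"
      using dist_triangle[of z v x] z v pos by linarith
    then have "v \<in> L z" using L(2)[of z] v by auto
    moreover have "dist z y < 3 * r" "dist v y < \<eta>" if "dist x y < \<rho>" for y
      using dist_triangle[of z y x] dist_triangle[of v y x] that z v pos
      by (auto simp: \<eta>_def algebra_simps dist_commute)
    ultimately have "ball x \<rho> \<subseteq> ball z (3 * r) \<inter> nbhd (L z) \<eta>"
      unfolding nbhd_def by auto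
    then show ?thesis using z(1) by blast
  qed
  then have sub: "(\<Union>x\<in>Z. ball x \<rho>) \<subseteq> (\<Union>z\<in>J. ball z (3 * r) \<inter> nbhd (L z) \<eta>)"
    by blast
  have meas: "ball z (3 * r) \<inter> nbhd (L z) \<eta> \<in> sets \<mu>" for z
    unfolding borel nbhd_def by (intro borel_open open_Int open_UN) auto
  have "real (card Z) * (a * \<rho> powr \<delta>) \<le> measure \<mu> (\<Union>x\<in>Z. ball x \<rho>)"
    using Z r pos lower E by (intro card_mult_le_measure_UN_balls[OF fin borel]) auto
  also have "\<dots> \<le> measure \<mu> (\<Union>z\<in>J. ball z (3 * r) \<inter> nbhd (L z) \<eta>)"
    using J meas by (intro finite_measure_mono sub sets.finite_UN) auto
  also have "\<dots> \<le> (\<Sum>z\<in>J. measure \<mu> (ball z (3 * r) \<inter> nbhd (L z) \<eta>))"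
    using J meas by (intro finite_measure_subadditive_finite) auto
  also have "\<dots> \<le> (\<Sum>z\<in>J. C * (\<eta> / (3 * r)) powr \<alpha> * (b * (3 * r) powr \<delta>))"
  proof (rule sum_mono)
    fix z assume "z \<in> J"
    then have z: "z \<in> K" using J by blast
    have "measure \<mu> (ball z (3 * r) \<inter> nbhd (L z) \<eta>) \<le> C * (\<eta> / (3 * r)) powr \<alpha> * measure \<mu> (ball z (3 * r))"
      using z L \<eta> r pos by (intro decay) auto
    also have "\<dots> \<le> C * (\<eta> / (3 * r)) powr \<alpha> * (b * (3 * r) powr \<delta>)"
      using z r pos by (intro mult_left_mono upper) auto
    finally show "measure \<mu> (ball z (3 * r) \<inter> nbhd (L z) \<eta>) \<le> C * (\<eta> / (3 * r)) powr \<alpha> * (b * (3 * r) powr \<delta>)" .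
  qed
  also have "\<dots> = real (card J) * (C * (\<eta> / (3 * r)) powr \<alpha> * (b * (3 * r) powr \<delta>))"
    by simp
  also have "\<dots> \<le> m / (a * r powr \<delta>) * (C * (\<eta> / (3 * r)) powr \<alpha> * (b * (3 * r) powr \<delta>))"
    using pos by (intro mult_right_mono cardJ) auto
  also have "(\<eta> / (3 * r)) powr \<alpha> = (\<kappa> + 1) powr \<alpha> * \<rho> powr \<alpha> / (3 powr \<alpha> * r powr \<alpha>)"
    using pos r by (simp add: \<eta>_def powr_mult powr_divide)
  also have "(3 * r) powr \<delta> = 3 powr \<delta> * r powr \<delta>"
    using r by (simp add: powr_mult)
  \<comment> \<open>The power \<open>r powr \<delta>\<close> cancels against the count of
    \<open>J\<close>, leaving \<open>r powr (- \<alpha>)\<close>. The factor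
    \<open>a * \<rho> powr \<delta>\<close> is split off for cancellation with the left-hand side,
    which is why \<open>a\<close> appears squared.\<close>
  also have "m / (a * r powr \<delta>) * (C * ((\<kappa> + 1) powr \<alpha> * \<rho> powr \<alpha> / (3 powr \<alpha> * r powr \<alpha>))
        * (b * (3 powr \<delta> * r powr \<delta>))) = (m * C * (\<kappa> + 1) powr \<alpha> * b * 3 powr (\<delta> - \<alpha>) / a\<^sup>2 * \<rho> powr (\<alpha> - \<delta>) * r powr (- \<alpha>))
      * (a * \<rho> powr \<delta>)"
    using pos r by (simp add: powr_diff powr_minus field_simps power2_eq_square)
  finally have "real (card Z) \<le> m * C * (\<kappa> + 1) powr \<alpha> * b * 3 powr (\<delta> - \<alpha>) / a\<^sup>2 * \<rho> powr (\<alpha> - \<delta>) * r powr (- \<alpha>)"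
    by (rule mult_right_le_imp_le) (use pos in auto)
  then show thesis using that Z unfolding m_def by blast
qed

section \<open>Dyadic levels of approximable points\<close>

lemma finite_bounded_int_vectors: "finite {p :: int ^ 'd. \<forall>i. \<bar>p $ i\<bar> \<le> B}"
proof (rule finite_imageD)
  have "vec_nth ` {p :: int ^ 'd. \<forall>i. \<bar>p $ i\<bar> \<le> B} \<subseteq> (UNIV :: 'd set) \<rightarrow>\<^sub>E {-B..B}"
    by (auto simp: abs_le_iff) (metis minus_le_iff)
  then show "finite (vec_nth ` {p :: int ^ 'd. \<forall>i. \<bar>p $ i\<bar> \<le> B})"
    by (rule finite_subset) (intro finite_PiE; simp)
qed (auto intro: inj_onI simp: vec_eq_iff)

definition dyadic_approximable :: "(real \<Rightarrow> real) \<Rightarrow> nat \<Rightarrow> (real ^ 'd) set" where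
  "dyadic_approximable \<psi> n =
     {x. \<exists>(p :: int ^ 'd) q :: nat. 2 ^ n \<le> q \<and> q < 2 ^ Suc n \<and>
           (\<forall>i. \<bar>x $ i - of_int (p $ i) / real q\<bar> \<le> \<psi> (real q))}"

text \<open>If \<open>x\<close> occurred only at levels below \<open>m\<close>, all its denominators
  would be below \<open>2 ^ m\<close>; as \<open>\<psi>\<close> is at most \<open>\<psi> 1\<close>
  at each of them, the numerators would be bounded as well, leaving finitely many pairs.\<close>

lemma well_approximable_frequently_dyadic:
  fixes x :: "real ^ 'd"
  assumes x: "x \<in> well_approximable \<psi>" and \<psi>: "antimono_on {0<..} \<psi>"
  shows "\<exists>n\<ge>m. x \<in> dyadic_approximable \<psi> n"
proof (rule ccontr)
  assume contra: "\<not> ?thesis"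
  define B where "B = \<lceil>2 ^ m * (norm x + \<bar>\<psi> 1\<bar>)\<rceil>"
  let ?S = "{(p :: int ^ 'd, q :: nat). q > 0 \<and>
            (MAX i\<in>UNIV. \<bar>x $ i - of_int (p $ i) / real q\<bar>) \<le> \<psi> (real q)}"
  have "?S \<subseteq> {p. \<forall>i. \<bar>p $ i\<bar> \<le> B} \<times> {..<2 ^ m}"
  proof clarify
    fix p :: "int ^ 'd" and q :: nat
    assume q: "q > 0" and max: "(MAX i\<in>UNIV. \<bar>x $ i - of_int (p $ i) / real q\<bar>) \<le> \<psi> (real q)"
    have close: "\<bar>x $ i - of_int (p $ i) / real q\<bar> \<le> \<psi> (real q)" for i
      using max by (subst (asm) Max_le_iff) auto
    obtain n where n: "2 ^ n \<le> q" "q < 2 ^ Suc n"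
      using ex_power_ivl1[of 2 q] q by auto
    then have "x \<in> dyadic_approximable \<psi> n"
      unfolding dyadic_approximable_def using close by blast
    then have "n < m" using contra by (meson not_less)
    then have "(2::nat) ^ Suc n \<le> 2 ^ m"
      by (intro power_increasing) auto
    with n(2) have qm: "q < 2 ^ m" by linarith
    have "\<bar>p $ i\<bar> \<le> B" for i
    proof -
      have "\<psi> (real q) \<le> \<psi> 1"
        using monotone_onD[OF \<psi>, of 1 "real q"] q by simp
      then have "\<bar>of_int (p $ i) / real q\<bar> \<le> norm x + \<bar>\<psi> 1\<bar>"
        using close[of i] component_le_norm_cart[of x i] by linarith
      then have "\<bar>real_of_int (p $ i)\<bar> \<le> real q * (norm x + \<bar>\<psi> 1\<bar>)"
        using q by (simp add: field_simps)
      also have "\<dots> \<le> 2 ^ m * (norm x + \<bar>\<psi> 1\<bar>)"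
        using qm by (intro mult_right_mono) (auto simp: of_nat_less_numeral_power_cancel_iff less_imp_le)
      finally show ?thesis unfolding B_def by linarith
    qed
    then show "p \<in> {p. \<forall>i. \<bar>p $ i\<bar> \<le> B} \<and> q \<in> {..<2 ^ m}"
      using qm by simp
  qed
  then have "finite ?S"
    by (rule finite_subset) (simp add: finite_bounded_int_vectors)
  then show False using x by (simp add: well_approximable_def)
qed

text \<open>The factor \<open>CARD('d)\<close> is the price of passing from the maximum norm to the
  Euclidean norm through the sum norm.\<close>

lemma dyadic_approximable_near_rational_points:
  fixes x :: "real ^ 'd"
  assumes x: "x \<in> dyadic_approximable \<psi> n" and \<psi>: "antimono_on {0<..} \<psi>"
  shows "\<exists>v\<in>rational_points (2 ^ Suc n). dist x v \<le> real CARD('d) * \<psi> (2 ^ n)"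
proof -
  obtain p :: "int ^ 'd" and q :: nat where q: "2 ^ n \<le> q" "q < 2 ^ Suc n"
    and close: "\<And>i. \<bar>x $ i - of_int (p $ i) / real q\<bar> \<le> \<psi> (real q)"
    using x unfolding dyadic_approximable_def by blast
  have q0: "0 < q" using q(1) by (metis less_le_trans zero_less_numeral zero_less_power)
  define v :: "real ^ 'd" where "v = (\<chi> i. of_int (p $ i) / real q)"
  have "real (2 ^ n) \<le> real q" using q(1) by (simp only: of_nat_le_iff)
  then have "\<psi> (real q) \<le> \<psi> (2 ^ n)"
    using monotone_onD[OF \<psi>, of "2 ^ n" "real q"] q0 by simp
  then have "\<bar>(x - v) $ i\<bar> \<le> \<psi> (2 ^ n)" for i
    using close[of i] by (simp add: v_def)
  then have "(\<Sum>i\<in>UNIV. \<bar>(x - v) $ i\<bar>) \<le> real CARD('d) * \<psi> (2 ^ n)"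
    by (intro sum_bounded_above) auto
  then have "dist x v \<le> real CARD('d) * \<psi> (2 ^ n)"
    unfolding dist_norm using norm_le_l1_cart[of "x - v"] by linarith
  moreover have "v \<in> rational_points (2 ^ Suc n)"
    unfolding rational_points_def v_def using q q0
    by (intro CollectI exI[of _ p] exI[of _ q]) auto
  ultimately show ?thesis by blast
qed

section \<open>Exponents, scales and the final estimate\<close>

text \<open>For \<open>\<tau> \<le> 0\<close> the factor
  \<open>\<psi> (real (Suc n)) powr \<tau>\<close> is at least
  \<open>\<psi> 1 powr \<tau> > 0\<close>, so the series would dominate a multiple of the sum of
  \<open>n powr (\<beta> - 1)\<close>, which diverges for \<open>\<beta> > 0\<close>.\<close>

lemma exponent_pos_if_summable:
  fixes \<psi> :: "real \<Rightarrow> real"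
  assumes "0 < \<beta>" and \<psi>: "\<And>t. t > 0 \<Longrightarrow> \<psi> t > 0" "antimono_on {0<..} \<psi>"
    and sum: "summable (\<lambda>n. real (Suc n) powr (\<beta> - 1) * \<psi> (real (Suc n)) powr \<tau>)"
  shows "0 < \<tau>"
proof (rule ccontr)
  assume "\<not> 0 < \<tau>"
  have "summable (\<lambda>n. real (Suc n) powr (\<beta> - 1) * \<psi> 1 powr \<tau>)"
  proof (rule summable_comparison_test'[OF sum])
    fix n :: nat
    have "\<psi> (real (Suc n)) \<le> \<psi> 1"
      using monotone_onD[OF \<psi>(2), of 1 "real (Suc n)"] by simp
    then have "\<psi> 1 powr \<tau> \<le> \<psi> (real (Suc n)) powr \<tau>"
      using \<psi>(1) \<open>\<not> 0 < \<tau>\<close> by (intro powr_mono2') auto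
    then show "norm (real (Suc n) powr (\<beta> - 1) * \<psi> 1 powr \<tau>)
        \<le> real (Suc n) powr (\<beta> - 1) * \<psi> (real (Suc n)) powr \<tau>"
      by (simp add: mult_left_mono)
  qed
  then have "summable (\<lambda>n. real (Suc n) powr (\<beta> - 1))"
    using \<psi>(1)[of 1] summable_mult2[of "\<lambda>n. real (Suc n) powr (\<beta> - 1) * \<psi> 1 powr \<tau>" "1 / \<psi> 1 powr \<tau>"]
    by simp
  then have "summable (\<lambda>n. real n powr (\<beta> - 1))"
    using summable_Suc_iff[of "\<lambda>n. real n powr (\<beta> - 1)"] by simp
  then have "\<beta> - 1 < -1"
    by (simp add: summable_real_powr_iff)
  then show False using \<open>0 < \<beta>\<close> by simp
qed

text \<open>The \<open>d\<close>-th power of the scale cancels the growth of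
  \<open>(2 ^ n) ^ Suc d\<close> exactly. Since \<open>u \<le> 1\<close> gives
  \<open>u ^ d \<le> u\<close>, one factor \<open>u\<close> pays for the factorial and for
  \<open>2 ^ Suc d\<close>, leaving 1/2.\<close>

lemma simplex_scale_small:
  fixes d n :: nat
  assumes "0 < d"
  defines "u \<equiv> 1 / (fact (Suc d) * 2 ^ (d + 2)) :: real"
  shows "fact (Suc d) * (u * (2 ^ n) powr (- ((real d + 1) / real d))) ^ d * real (2 ^ Suc n) ^ Suc d < 1"
proof -
  have u: "0 < u" "u \<le> 1"
  proof -
    have "1 * 1 \<le> (fact (Suc d) * 2 ^ (d + 2) :: real)"
      by (intro mult_mono fact_ge_1 one_le_power) auto
    then show "u \<le> 1" unfolding u_def by (simp add: divide_le_eq_1)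
  qed (simp add: u_def)
  have "((2 ^ n) powr (- ((real d + 1) / real d)) :: real) ^ d = (2 ^ n) powr (- real (Suc d))"
    using assms(1) by (simp add: powr_power minus_diff_commute)
  also have "\<dots> = 1 / (2 ^ n) ^ Suc d"
    by (simp add: powr_minus_divide powr_realpow del: power_Suc of_nat_Suc)
  finally have "fact (Suc d) * (u * (2 ^ n) powr (- ((real d + 1) / real d))) ^ d * real (2 ^ Suc n) ^ Suc d
      = fact (Suc d) * u ^ d * 2 ^ Suc d"
    by (simp add: power_mult_distrib field_simps)
  also have "\<dots> \<le> fact (Suc d) * u * 2 ^ Suc d"
    using u assms(1) power_decreasing[of 1 d u] by (intro mult_left_mono mult_right_mono) auto
  also have "\<dots> = 1 / 2"
    by (simp add: u_def field_simps del: fact_Suc)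
  finally show ?thesis by simp
qed

theorem theorem2:
  fixes K :: "(real ^ 'd) set" and \<mu> :: "(real ^ 'd) measure"
    and \<psi> :: "real \<Rightarrow> real" and \<alpha> a b \<delta> r\<^sub>0 s :: real
  assumes "compact K"
    and "sets \<mu> = sets borel" and "finite_measure \<mu>" and "non_atomic \<mu>"
    and "emeasure \<mu> (- K) = 0"
    and "\<alpha> > 0" and "absolutely_friendly \<alpha> K \<mu>"
    and "a > 0" and "b > 0" and "\<delta> > 0" and "r\<^sub>0 > 0"
    and "\<And>x r. x \<in> K \<Longrightarrow> 0 < r \<Longrightarrow> r < r\<^sub>0 \<Longrightarrow>
           ennreal (a * r powr \<delta>) \<le> emeasure \<mu> (ball x r) \<and>
           emeasure \<mu> (ball x r) \<le> ennreal (b * r powr \<delta>)"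
    and "\<And>t. t > 0 \<Longrightarrow> \<psi> t > 0" and "antimono_on {0<..} \<psi>"
    and "0 \<le> s" and "s \<le> \<delta>"
    and "summable (\<lambda>n. real (Suc n) powr (\<alpha> * (real CARD('d) + 1) / real CARD('d) - 1)
                         * \<psi> (real (Suc n)) powr (\<alpha> + s - \<delta>))"
  shows "hausdorff_measure s (K \<inter> well_approximable \<psi>) = 0"
proof -
  define d where "d = CARD('d)"
  have d: "0 < d" "1 \<le> real d"
    unfolding d_def by (simp_all add: Suc_le_eq)
  define \<gamma> where "\<gamma> = (real d + 1) / real d"
  define \<tau> where "\<tau> = \<alpha> + s - \<delta>"
  define u :: real where "u = 1 / (fact (Suc d) * 2 ^ (d + 2))"
  \<comment> \<open>The 6 is 2 times 3: the simplex lemma is applied to balls of radius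
    \<open>3 * r n\<close> and involves their diameter.\<close>
  define r where "r n = u / 6 * (2 ^ n) powr (- \<gamma>)" for n
  define \<rho> where "\<rho> n = \<psi> (2 ^ n)" for n
  define f where "f n = (2 ^ n) powr (\<alpha> * \<gamma>) * \<rho> n powr \<tau>" for n
  interpret finite_measure \<mu> by fact
  have u: "0 < u" by (simp add: u_def)
  have \<gamma>: "0 < \<gamma>" using d by (simp add: \<gamma>_def)
  have \<rho>: "0 < \<rho> n" for n by (simp add: \<rho>_def assms(13))
  have r: "0 < r n" for n using u by (simp add: r_def)
  have sum: "summable (\<lambda>n. real (Suc n) powr (\<alpha> * \<gamma> - 1) * \<psi> (real (Suc n)) powr \<tau>)"
    using assms(17) by (simp add: \<gamma>_def \<tau>_def d_def)
  \<comment> \<open>Positivity makes the power \<open>\<tau>\<close> increasing, as needed for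
    condensation and for comparing \<open>\<rho>\<close> with \<open>r\<close>.\<close>
  have \<tau>: "0 < \<tau>"
    using exponent_pos_if_summable[OF _ assms(13,14) sum] \<open>\<alpha> > 0\<close> \<gamma> by simp
  have sumf: "summable f"
  proof -
    have "summable (\<lambda>n. (2 ^ n) powr (\<alpha> * \<gamma>) * \<psi> (real (2 ^ n)) powr \<tau>)"
    proof (rule summable_dyadic_condensation[OF sum])
      show "\<psi> (real n) powr \<tau> \<le> \<psi> (real m) powr \<tau>" if "0 < m" "m \<le> n" for m n
        using that monotone_onD[OF assms(14), of "real m" "real n"] assms(13)[of "real n"] \<tau>
        by (intro powr_mono2) auto
    qed simp
    then show ?thesis by (simp add: f_def[abs_def] \<rho>_def)
  qed

  obtain C r\<^sub>1 where C: "0 < C" "0 < r\<^sub>1"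
    and decay_e: "\<And>L \<epsilon> x t. affine_hyperplane L \<Longrightarrow> 0 < \<epsilon> \<Longrightarrow> x \<in> K \<Longrightarrow> 0 < t \<Longrightarrow> t < r\<^sub>1 \<Longrightarrow>
      emeasure \<mu> (ball x t \<inter> nbhd L \<epsilon>) \<le> ennreal (C * (\<epsilon> / t) powr \<alpha>) * emeasure \<mu> (ball x t)"
    using assms(7) unfolding absolutely_friendly_def absolutely_decaying_def by metis
  define R where "R = min r\<^sub>0 r\<^sub>1"
  have R: "0 < R" "R \<le> r\<^sub>0" "R \<le> r\<^sub>1" using C assms(11) by (auto simp: R_def)
  have decay: "measure \<mu> (ball x t \<inter> nbhd L \<epsilon>) \<le> C * (\<epsilon> / t) powr \<alpha> * measure \<mu> (ball x t)"
    if "affine_hyperplane L" "0 < \<epsilon>" "x \<in> K" "0 < t" "t < R" for L \<epsilon> x t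
  proof -
    have "ennreal (measure \<mu> (ball x t \<inter> nbhd L \<epsilon>)) \<le> ennreal (C * (\<epsilon> / t) powr \<alpha> * measure \<mu> (ball x t))"
      using decay_e[of L \<epsilon> x t] that R C by (simp add: emeasure_eq_measure ennreal_mult)
    then show ?thesis using C by (subst (asm) ennreal_le_iff) auto
  qed
  have lower: "a * t powr \<delta> \<le> measure \<mu> (ball x t)" and upper: "measure \<mu> (ball x t) \<le> b * t powr \<delta>"
    if "x \<in> K" "0 < t" "t < R" for x t
    using assms(12)[of x t] that R assms(9) by (simp_all add: emeasure_eq_measure)

  have "(2 ^ n :: real) powr (- \<gamma>) = (2 powr (- \<gamma>)) ^ n" for n
    by (simp add: powr_power powr_powr mult.commute flip: powr_realpow)
  moreover have "(2 :: real) powr (- \<gamma>) < 1"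
    using powr_less_mono[of "- \<gamma>" 0 2] \<gamma> by simp
  then have "(\<lambda>n. ((2 :: real) powr (- \<gamma>)) ^ n) \<longlonglongrightarrow> 0"
    by (intro LIMSEQ_realpow_zero) auto
  ultimately have "(\<lambda>n. (2 ^ n :: real) powr (- \<gamma>)) \<longlonglongrightarrow> 0"
    by simp
  then have r_lim: "r \<longlonglongrightarrow> 0"
    unfolding r_def by (rule tendsto_mult_right_zero)
  have "\<forall>\<^sub>F n in sequentially. real d * \<rho> n \<le> r n"
  proof -
    \<comment> \<open>Chosen so that failure of \<open>real d * \<rho> n \<le> r n\<close> means
      that \<open>\<rho> n\<close> exceeds \<open>c * (2 ^ n) powr (- \<gamma>)\<close>. This would
      keep \<open>f n\<close> above \<open>c powr \<tau>\<close>, although \<open>f\<close> tends to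
      0.\<close>
    define c where "c = u / 6 / real d"
    have c: "0 < c" using u d by (simp add: c_def)
    have "\<forall>\<^sub>F n in sequentially. f n < c powr \<tau>"
      using summable_LIMSEQ_zero[OF sumf] c by (intro order_tendstoD) auto
    then show ?thesis
    proof (rule eventually_mono)
      fix n assume n: "f n < c powr \<tau>"
      show "real d * \<rho> n \<le> r n"
      proof (rule ccontr)
        assume "\<not> ?thesis"
        then have "c * (2 ^ n) powr (- \<gamma>) \<le> \<rho> n"
          using d by (simp add: r_def c_def field_simps)
        then have "(c * (2 ^ n) powr (- \<gamma>)) powr \<tau> \<le> \<rho> n powr \<tau>"
          using c \<tau> by (intro powr_mono2) auto
        then have "(2 ^ n) powr (\<alpha> * \<gamma>) * (c * (2 ^ n) powr (- \<gamma>)) powr \<tau> \<le> f n"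
          unfolding f_def by (intro mult_left_mono) auto
        \<comment> \<open>The exponents combine as \<open>\<alpha> * \<gamma> - \<gamma> * \<tau> =
          \<gamma> * (\<delta> - s)\<close>, which is nonnegative because
          \<open>s \<le> \<delta>\<close>.\<close>
        also have "(2 ^ n) powr (\<alpha> * \<gamma>) * (c * (2 ^ n) powr (- \<gamma>)) powr \<tau>
            = c powr \<tau> * (2 ^ n) powr (\<gamma> * (\<delta> - s))"
          using c by (simp add: powr_mult powr_powr powr_add[symmetric] \<tau>_def algebra_simps)
        finally have "c powr \<tau> * (2 ^ n) powr (\<gamma> * (\<delta> - s)) \<le> f n" .
        moreover have "1 \<le> (2 ^ n :: real) powr (\<gamma> * (\<delta> - s))"
          using \<gamma> assms(16) by (intro ge_one_powr_ge_zero) auto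
        then have "c powr \<tau> * 1 \<le> c powr \<tau> * (2 ^ n) powr (\<gamma> * (\<delta> - s))"
          by (intro mult_left_mono) auto
        ultimately show False using n by linarith
      qed
    qed
  qed
  moreover have "\<forall>\<^sub>F n in sequentially. r n < R / 3"
    using r_lim R by (intro order_tendstoD) auto
  ultimately have "\<forall>\<^sub>F n in sequentially. real d * \<rho> n \<le> r n \<and> r n < R / 3"
    by (rule eventually_conj)
  then obtain N where N: "\<And>n. n \<ge> N \<Longrightarrow> real d * \<rho> n \<le> r n" "\<And>n. n \<ge> N \<Longrightarrow> r n < R / 3"
    unfolding eventually_sequentially by blast
  have \<rho>_le: "\<rho> n \<le> r n" if "n \<ge> N" for n
  proof -
    have "1 * \<rho> n \<le> real d * \<rho> n"
      using d \<rho>[of n] by (intro mult_right_mono) auto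
    then show ?thesis using N(1)[OF that] by linarith
  qed

  define A where "A = measure \<mu> (space \<mu>) * C * (real d + 1) powr \<alpha> * b * 3 powr (\<delta> - \<alpha>) / a\<^sup>2"
  have "\<exists>Z. finite Z \<and> K \<inter> dyadic_approximable \<psi> n \<subseteq> (\<Union>z\<in>Z. ball z (2 * \<rho> n)) \<and>
      real (card Z) \<le> A * \<rho> n powr (\<alpha> - \<delta>) * r n powr (- \<alpha>)" if n: "n \<ge> N" for n
  \<comment> \<open>Here \<open>\<kappa>\<close> is \<open>d\<close>, from the comparison of norms,
    and \<open>S\<close> consists of the rational points with denominator at most
    \<open>2 ^ Suc n\<close>, which include all those of level \<open>n\<close>.\<close>
  proof (rule card_cover_near_hyperplanes[OF assms(3,2), of a b C "real d" "\<rho> n" "r n" R K \<delta> \<alpha>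
        "rational_points (2 ^ Suc n)" "K \<inter> dyadic_approximable \<psi> n"])
    show "\<exists>L. affine_hyperplane L \<and> ball z (3 * r n) \<inter> rational_points (2 ^ Suc n) \<subseteq> L" for z :: "real ^ 'd"
    proof (rule rational_points_in_ball_subset_hyperplane)
      show "fact (Suc CARD('d)) * (2 * (3 * r n)) ^ CARD('d) * real (2 ^ Suc n) ^ Suc CARD('d) < 1"
      proof -
        have "2 * (3 * r n) = u * (2 ^ n) powr (- \<gamma>)" by (simp add: r_def)
        then show ?thesis
          using simplex_scale_small[OF d(1), of n] by (simp only: u_def \<gamma>_def d_def)
      qed
    qed (use r[of n] in simp)
    show "\<exists>v\<in>rational_points (2 ^ Suc n). dist x v \<le> real d * \<rho> n"
      if "x \<in> K \<inter> dyadic_approximable \<psi> n" for x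
      unfolding d_def \<rho>_def using that by (intro dyadic_approximable_near_rational_points assms(14)) auto
  qed (use assms(8,9) C N[OF n] \<rho>_le[OF n] \<rho> lower upper decay in \<open>auto simp: A_def\<close>)
  then obtain Z where Z: "\<And>n. n \<ge> N \<Longrightarrow> finite (Z n)"
    "\<And>n. n \<ge> N \<Longrightarrow> K \<inter> dyadic_approximable \<psi> n \<subseteq> (\<Union>z\<in>Z n. ball z (2 * \<rho> n))"
    "\<And>n. n \<ge> N \<Longrightarrow> real (card (Z n)) \<le> A * \<rho> n powr (\<alpha> - \<delta>) * r n powr (- \<alpha>)"
    by metis
  show ?thesis
  proof (rule hausdorff_measure_limsup_eq_0[OF Z(1) _ Z(2)])
    have "\<rho> \<longlonglongrightarrow> 0"
    proof (rule tendsto_sandwich[OF _ _ tendsto_const r_lim])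
      show "\<forall>\<^sub>F n in sequentially. 0 \<le> \<rho> n" using \<rho> by (simp add: less_imp_le)
      show "\<forall>\<^sub>F n in sequentially. \<rho> n \<le> r n" using \<rho>_le eventually_sequentially by blast
    qed
    then show "(\<lambda>n. 2 * \<rho> n) \<longlonglongrightarrow> 0" by (rule tendsto_mult_right_zero)
    show "summable (\<lambda>n. real (card (Z n)) * (2 * \<rho> n) powr s)"
    proof (rule summable_comparison_test')
      show "summable (\<lambda>n. (A * 2 powr s * (u / 6) powr (- \<alpha>)) * f n)"
        using sumf by (rule summable_mult)
      fix n assume n: "n \<ge> N"
      have "real (card (Z n)) * (2 * \<rho> n) powr s
          \<le> (A * \<rho> n powr (\<alpha> - \<delta>) * r n powr (- \<alpha>)) * (2 * \<rho> n) powr s"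
        using Z(3)[OF n] by (intro mult_right_mono) auto
      \<comment> \<open>The cost \<open>\<rho> n powr s\<close> of each ball raises the exponent of
        \<open>\<rho> n\<close> to \<open>\<tau>\<close>, and \<open>r n powr (- \<alpha>)\<close>
        supplies the power of \<open>2 ^ n\<close>; the product is a constant times
        \<open>f n\<close>.\<close>
      also have "\<rho> n powr (\<alpha> - \<delta>) = \<rho> n powr \<tau> / \<rho> n powr s"
        by (simp add: \<tau>_def powr_diff powr_add)
      also have "r n powr (- \<alpha>) = (u / 6) powr (- \<alpha>) * (2 ^ n) powr (\<alpha> * \<gamma>)"
        using u by (simp only: r_def powr_mult powr_powr) (simp add: mult.commute)
      also have "(2 * \<rho> n) powr s = 2 powr s * \<rho> n powr s"
        using \<rho>[of n] by (simp add: powr_mult)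
      also have "A * (\<rho> n powr \<tau> / \<rho> n powr s) * ((u / 6) powr (- \<alpha>) * (2 ^ n) powr (\<alpha> * \<gamma>))
          * (2 powr s * \<rho> n powr s) = (A * 2 powr s * (u / 6) powr (- \<alpha>)) * f n"
        using \<rho>[of n] by (simp add: f_def)
      finally show "norm (real (card (Z n)) * (2 * \<rho> n) powr s)
          \<le> (A * 2 powr s * (u / 6) powr (- \<alpha>)) * f n"
        using \<rho>[of n] by (simp add: powr_mult)
    qed
    show "\<exists>n\<ge>m. x \<in> K \<inter> dyadic_approximable \<psi> n" if "x \<in> K \<inter> well_approximable \<psi>" for x m
      using that well_approximable_frequently_dyadic[OF _ assms(14), of x m] by auto
  qed (use \<rho> in auto)
qed

end
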